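(* Let $\mathcal{A}$ be any alphabet set (a discrete set, finite or infinite, or a metric space $(\mathcal{A},d)$), let $(\Omega,\sigma)$ be a subshift of $(\mathcal{A}^{\mathbb{N}},\sigma)$, and let $\overline{\sigma}$ be the induced map on the hyperspace $\mathcal{K}(\Omega)$ of nonempty compact subsets of $\Omega$. If $(\mathcal{K}(\Omega),\overline{\sigma})$ is expansive, then $(\Omega,\sigma)$ is expansive. The converse does not hold in general: there exist an alphabet set $\mathcal{A}$ and a subshift $\Omega\subseteq\mathcal{A}^{\mathbb{N}}$ such that $(\Omega,\sigma)$ is expansive but $(\mathcal{K}(\Omega),\overline{\sigma})$ is not expansive.
   Context: Sequences are indexed from $0$ and $\sigma(x_0x_1x_2\ldots)=x_1x_2x_3\ldots$. A subshift of $\mathcal{A}^{\mathbb{N}}$ is a nonempty closed subset $\Omega$ with $\sigma(\Omega)\subseteq\Omega$ (the full shift $\mathcal{A}^{\mathbb{N}}$ is allowed). The space $\mathcal{A}^{\mathbb{N}}$ carries the metric $D$, where $D(\bar x,\bar y)=\sum_{i=0}^\infty \frac{\delta(x_i,y_i)}{2^i}$ ($\delta$ the discrete metric) if $\mathcal{A}$ is a discrete alphabet, and $D(\bar x,\bar y)=\sum_{i=0}^\infty \frac{1}{2^i}\frac{d(x_i,y_i)}{1+d(x_i,y_i)}$ if $\mathcal{A}$ is a general metric space. $\mathcal{K}(\Omega)$ carries the Hausdorff metric $D_H$ induced by $D$, and $\overline{\sigma}(K)=\sigma(K)$. A continuous self-map $f$ of a metric space $(X,\rho)$ is expansive if there is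 $\delta>0$ such that for any two distinct points $x,y\in X$ there is an integer $k\ge 0$ with $\rho(f^k(x),f^k(y))>\delta$. *)

theory Defs
  imports "HOL-Analysis.Analysis"
begin

section \<open>Alphabets and sequence spaces\<close>

text \<open>
  The two kinds of alphabet are kept apart because they induce different formulas for the metric
  on sequences: a discrete alphabet is not treated as a metric alphabet carrying the discrete metric.
\<close>

datatype 'a alphabet = Discrete_Alphabet "'a set" | Metric_Alphabet "'a metric"

fun letters :: "'a alphabet \<Rightarrow> 'a set" where
  "letters (Discrete_Alphabet A) = A"
| "letters (Metric_Alphabet m) = mspace m"

fun letter_dist :: "'a alphabet \<Rightarrow> 'a \<Rightarrow> 'a \<Rightarrow> real" where
  "letter_dist (Discrete_Alphabet A) a b = discrete_metric.dd a b"
| "letter_dist (Metric_Alphabet m) a b = mdist m a b / (1 + mdist m a b)"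

definition sequences :: "'a alphabet \<Rightarrow> (nat \<Rightarrow> 'a) set" where
  "sequences \<A> = {x. range x \<subseteq> letters \<A>}"

definition seq_dist :: "'a alphabet \<Rightarrow> (nat \<Rightarrow> 'a) \<Rightarrow> (nat \<Rightarrow> 'a) \<Rightarrow> real" where
  "seq_dist \<A> x y = (\<Sum>i. letter_dist \<A> (x i) (y i) / 2 ^ i)"

definition seq_metric :: "'a alphabet \<Rightarrow> (nat \<Rightarrow> 'a) metric" where
  "seq_metric \<A> = metric (sequences \<A>, seq_dist \<A>)"

lemma letter_dist_bounds: "0 \<le> letter_dist \<A> a b" "letter_dist \<A> a b \<le> 1"
proof -
  have "0 \<le> letter_dist \<A> a b \<and> letter_dist \<A> a b \<le> 1"
    by (cases \<A>) (auto simp: discrete_metric.dd_def divide_le_eq_1 add_pos_nonneg)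
  then show "0 \<le> letter_dist \<A> a b" "letter_dist \<A> a b \<le> 1" by auto
qed

lemma Metric_space_letter_dist: "Metric_space (letters \<A>) (letter_dist \<A>)"
proof (cases \<A>)
  case (Discrete_Alphabet A)
  then have "letter_dist \<A> = discrete_metric.dd" by (intro ext) simp
  then show ?thesis using metric_M_dd by metis
next
  case (Metric_Alphabet m)
  interpret M: Metric_space "mspace m" "mdist m" by simp
  have tri: "mdist m x z / (1 + mdist m x z)
      \<le> mdist m x y / (1 + mdist m x y) + mdist m y z / (1 + mdist m y z)"
    if "x \<in> mspace m" "y \<in> mspace m" "z \<in> mspace m" for x y z
  proof -
    define a b c where "a = mdist m x z" and "b = mdist m x y" and "c = mdist m y z"
    have *: "a \<le> b + c" "0 \<le> a" "0 \<le> b" "0 \<le> c"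
      using that M.triangle unfolding a_def b_def c_def by auto
    have "a / (1 + a) \<le> (b + c) / (1 + (b + c))"
      using * by (simp add: divide_simps) (simp add: algebra_simps)
    also have "\<dots> = b / (1 + (b + c)) + c / (1 + (b + c))"
      by (simp add: add_divide_distrib)
    also have "\<dots> \<le> b / (1 + b) + c / (1 + c)"
      using * by (intro add_mono divide_left_mono) auto
    finally show ?thesis unfolding a_def b_def c_def .
  qed
  show ?thesis
    unfolding Metric_Alphabet
  proof
    fix x y z :: 'a
    show "0 \<le> letter_dist (Metric_Alphabet m) x y" by (rule letter_dist_bounds)
    show "letter_dist (Metric_Alphabet m) x y = letter_dist (Metric_Alphabet m) y x"
      by (simp add: M.commute)
    assume "x \<in> letters (Metric_Alphabet m)" "y \<in> letters (Metric_Alphabet m)"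
    then have xy: "x \<in> mspace m" "y \<in> mspace m" by auto
    have "1 + mdist m x y \<noteq> 0" using M.nonneg[of x y] by linarith
    then show "letter_dist (Metric_Alphabet m) x y = 0 \<longleftrightarrow> x = y"
      using xy by simp
    assume "z \<in> letters (Metric_Alphabet m)"
    then show "letter_dist (Metric_Alphabet m) x z
        \<le> letter_dist (Metric_Alphabet m) x y + letter_dist (Metric_Alphabet m) y z"
      using tri xy by simp
  qed
qed

lemma summable_seq_dist: "summable (\<lambda>i. letter_dist \<A> (x i) (y i) / 2 ^ i)"
proof (rule summable_comparison_test')
  show "summable (\<lambda>i. (1/2 :: real) ^ i)" by (rule summable_geometric) simp
  show "norm (letter_dist \<A> (x i) (y i) / 2 ^ i) \<le> (1/2) ^ i" if "i \<ge> 0" for i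
    using letter_dist_bounds[of \<A> "x i" "y i"] by (simp add: power_one_over divide_right_mono)
qed

lemma Metric_space_seq_dist: "Metric_space (sequences \<A>) (seq_dist \<A>)"
proof -
  interpret L: Metric_space "letters \<A>" "letter_dist \<A>" by (rule Metric_space_letter_dist)
  show ?thesis
  proof
    fix x y z :: "nat \<Rightarrow> 'a"
    show "0 \<le> seq_dist \<A> x y"
      unfolding seq_dist_def by (intro suminf_nonneg summable_seq_dist) simp
    show "seq_dist \<A> x y = seq_dist \<A> y x"
      unfolding seq_dist_def by (simp add: L.commute)
    assume "x \<in> sequences \<A>" "y \<in> sequences \<A>"
    then have xy: "x i \<in> letters \<A>" "y i \<in> letters \<A>" for i
      by (auto simp: sequences_def)
    have "seq_dist \<A> x y = 0 \<longleftrightarrow> (\<forall>i. letter_dist \<A> (x i) (y i) / 2 ^ i = 0)"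
      unfolding seq_dist_def by (intro suminf_eq_zero_iff summable_seq_dist) simp
    then show "seq_dist \<A> x y = 0 \<longleftrightarrow> x = y"
      using xy by auto
    assume "z \<in> sequences \<A>"
    then have z: "z i \<in> letters \<A>" for i
      by (auto simp: sequences_def)
    have "seq_dist \<A> x z
        \<le> (\<Sum>i. letter_dist \<A> (x i) (y i) / 2 ^ i + letter_dist \<A> (y i) (z i) / 2 ^ i)"
      unfolding seq_dist_def
    proof (intro suminf_le summable_add summable_seq_dist)
      fix i
      show "letter_dist \<A> (x i) (z i) / 2 ^ i
          \<le> letter_dist \<A> (x i) (y i) / 2 ^ i + letter_dist \<A> (y i) (z i) / 2 ^ i"
        using L.triangle[OF xy(1)[of i] xy(2)[of i] z[of i]]
        by (simp add: add_divide_distrib[symmetric] divide_right_mono)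
    qed
    also have "\<dots> = seq_dist \<A> x y + seq_dist \<A> y z"
      unfolding seq_dist_def by (intro suminf_add[symmetric] summable_seq_dist)
    finally show "seq_dist \<A> x z \<le> seq_dist \<A> x y + seq_dist \<A> y z" .
  qed
qed

lemma mspace_seq_metric [simp]: "mspace (seq_metric \<A>) = sequences \<A>"
  and mdist_seq_metric [simp]: "mdist (seq_metric \<A>) = seq_dist \<A>"
  unfolding seq_metric_def
  by (simp_all add: Metric_space.mspace_metric Metric_space.mdist_metric Metric_space_seq_dist)


section \<open>Subshifts\<close>

definition shift :: "(nat \<Rightarrow> 'a) \<Rightarrow> nat \<Rightarrow> 'a" where
  "shift x = (\<lambda>i. x (Suc i))"

definition subshift :: "'a alphabet \<Rightarrow> (nat \<Rightarrow> 'a) set \<Rightarrow> bool" where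
  "subshift \<A> \<Omega> \<longleftrightarrow>
     \<Omega> \<noteq> {} \<and> closedin (mtopology_of (seq_metric \<A>)) \<Omega> \<and> shift ` \<Omega> \<subseteq> \<Omega>"

definition subshift_metric :: "'a alphabet \<Rightarrow> (nat \<Rightarrow> 'a) set \<Rightarrow> (nat \<Rightarrow> 'a) metric" where
  "subshift_metric \<A> \<Omega> = submetric (seq_metric \<A>) \<Omega>"

lemma seq_dist_shift_le: "seq_dist \<A> (shift x) (shift y) \<le> 2 * seq_dist \<A> x y"
proof -
  let ?f = "\<lambda>i. letter_dist \<A> (x i) (y i) / 2 ^ i"
  have "seq_dist \<A> (shift x) (shift y) = (\<Sum>i. 2 * ?f (Suc i))"
    by (simp add: seq_dist_def shift_def)
  also have "\<dots> = 2 * (\<Sum>i. ?f (Suc i))"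
    by (intro suminf_mult iffD2[OF summable_Suc_iff, of ?f] summable_seq_dist)
  also have "(\<Sum>i. ?f (Suc i)) = seq_dist \<A> x y - ?f 0"
    unfolding seq_dist_def by (rule suminf_split_head[OF summable_seq_dist])
  finally show ?thesis
    using letter_dist_bounds(1)[of \<A> "x 0" "y 0"] by simp
qed

lemma mspace_subshift_metric:
  assumes "subshift \<A> \<Omega>"
  shows "mspace (subshift_metric \<A> \<Omega>) = \<Omega>"
proof -
  have "\<Omega> \<subseteq> sequences \<A>"
    using assms closedin_subset[of "mtopology_of (seq_metric \<A>)" \<Omega>] by (simp add: subshift_def)
  then show ?thesis by (auto simp: subshift_metric_def)
qed

lemma mdist_subshift_metric [simp]: "mdist (subshift_metric \<A> \<Omega>) = seq_dist \<A>"
  by (simp add: subshift_metric_def)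

lemma Lipschitz_shift:
  assumes "subshift \<A> \<Omega>"
  shows "Lipschitz_continuous_map (subshift_metric \<A> \<Omega>) (subshift_metric \<A> \<Omega>) shift"
  unfolding Lipschitz_continuous_map_def mspace_subshift_metric[OF assms] mdist_subshift_metric
proof (intro conjI exI ballI)
  show "shift \<in> \<Omega> \<rightarrow> \<Omega>" using assms by (auto simp: subshift_def)
  show "seq_dist \<A> (shift x) (shift y) \<le> 2 * seq_dist \<A> x y" for x y
    by (rule seq_dist_shift_le)
qed


section \<open>The hyperspace of nonempty compact subsets\<close>

definition hyperspace :: "'a metric \<Rightarrow> 'a set set" where
  "hyperspace m = {K. K \<noteq> {} \<and> compactin (mtopology_of m) K}"

text \<open>
  The distance is set to \<open>0\<close> outside the hyperspace because \<^locale>\<open>Metric_space\<close> asks for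
  nonnegativity and symmetry for all arguments, not only for those in the carrier.
\<close>

definition hausdorff_dist :: "'a metric \<Rightarrow> 'a set \<Rightarrow> 'a set \<Rightarrow> real" where
  "hausdorff_dist m K L =
     (if K \<in> hyperspace m \<and> L \<in> hyperspace m
      then max (SUP x\<in>K. INF y\<in>L. mdist m x y) (SUP y\<in>L. INF x\<in>K. mdist m x y)
      else 0)"

definition hyperspace_metric :: "'a metric \<Rightarrow> 'a set metric" where
  "hyperspace_metric m = metric (hyperspace m, hausdorff_dist m)"

definition induced_map :: "('a \<Rightarrow> 'a) \<Rightarrow> 'a set \<Rightarrow> 'a set" where
  "induced_map f K = f ` K"

lemma hyperspace_subset: "K \<in> hyperspace m \<Longrightarrow> K \<subseteq> mspace m"
  unfolding hyperspace_def using compactin_subset_topspace[of "mtopology_of m" K] by simp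

lemma hyperspace_bounded:
  assumes "K \<in> hyperspace m" "L \<in> hyperspace m"
  obtains B where "\<And>x y. x \<in> K \<Longrightarrow> y \<in> L \<Longrightarrow> mdist m x y \<le> B"
proof -
  interpret M: Metric_space "mspace m" "mdist m" by simp
  have "M.mbounded K" "M.mbounded L"
    using assms by (auto simp: hyperspace_def mtopology_of_def intro: M.compactin_imp_mbounded)
  then have "M.mbounded (K \<union> L)" by (simp add: M.mbounded_Un)
  then obtain B where "\<forall>x\<in>K \<union> L. \<forall>y\<in>K \<union> L. mdist m x y \<le> B"
    unfolding M.mbounded_alt by blast
  then show ?thesis using that by blast
qed

lemma SUP_INF_mdist_le_iff:
  assumes A: "A \<in> hyperspace m" and B: "B \<in> hyperspace m"
  shows "(SUP x\<in>A. INF y\<in>B. mdist m x y) \<le> r \<longleftrightarrow> (\<forall>x\<in>A. \<forall>e>0. \<exists>y\<in>B. mdist m x y < r + e)"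
proof -
  have ne: "A \<noteq> {}" "B \<noteq> {}" using A B by (auto simp: hyperspace_def)
  obtain C where C: "\<And>x y. x \<in> A \<Longrightarrow> y \<in> B \<Longrightarrow> mdist m x y \<le> C"
    using hyperspace_bounded[OF A B] by blast
  have below: "bdd_below (mdist m x ` B)" for x
    by (rule bdd_belowI2[where m=0]) simp
  have above: "bdd_above ((\<lambda>x. INF y\<in>B. mdist m x y) ` A)"
  proof (rule bdd_aboveI2)
    fix x assume "x \<in> A"
    obtain y where "y \<in> B" using ne by blast
    then show "(INF y\<in>B. mdist m x y) \<le> C"
      using C \<open>x \<in> A\<close> by (intro cINF_lower2[OF below]) auto
  qed
  have "(SUP x\<in>A. INF y\<in>B. mdist m x y) \<le> r \<longleftrightarrow> (\<forall>x\<in>A. (INF y\<in>B. mdist m x y) \<le> r)"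
    by (rule cSUP_le_iff[OF ne(1) above])
  also have "\<dots> \<longleftrightarrow> (\<forall>x\<in>A. \<forall>e>0. (INF y\<in>B. mdist m x y) < r + e)"
  proof (intro ball_cong refl iffI allI impI)
    fix x assume *: "\<forall>e>0. (INF y\<in>B. mdist m x y) < r + e"
    show "(INF y\<in>B. mdist m x y) \<le> r"
      by (rule field_le_epsilon) (use * in \<open>blast intro: less_imp_le\<close>)
  qed linarith
  also have "\<dots> \<longleftrightarrow> (\<forall>x\<in>A. \<forall>e>0. \<exists>y\<in>B. mdist m x y < r + e)"
    by (simp only: cINF_less_iff[OF ne(2) below])
  finally show ?thesis .
qed

lemma hausdorff_dist_commute: "hausdorff_dist m K L = hausdorff_dist m L K"
proof -
  have "mdist m = (\<lambda>x y. mdist m y x)" by (intro ext mdist_commute)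
  then have *: "(SUP x\<in>A. INF y\<in>B. mdist m x y) = (SUP x\<in>A. INF y\<in>B. mdist m y x)" for A B
    by metis
  show ?thesis
    unfolding hausdorff_dist_def *[of K L] *[of L K]
    by (simp only: max.commute conj_commute)
qed

lemma hausdorff_dist_le_iff:
  assumes K: "K \<in> hyperspace m" and L: "L \<in> hyperspace m"
  shows "hausdorff_dist m K L \<le> r \<longleftrightarrow>
    (\<forall>x\<in>K. \<forall>e>0. \<exists>y\<in>L. mdist m x y < r + e) \<and> (\<forall>y\<in>L. \<forall>e>0. \<exists>x\<in>K. mdist m y x < r + e)"
proof -
  have "hausdorff_dist m K L
      = max (SUP x\<in>K. INF y\<in>L. mdist m x y) (SUP y\<in>L. INF x\<in>K. mdist m y x)"
    unfolding hausdorff_dist_def using K L mdist_commute[of m] by presburger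
  then show ?thesis
    by (simp only: max.bounded_iff SUP_INF_mdist_le_iff[OF K L] SUP_INF_mdist_le_iff[OF L K])
qed

lemma hausdorff_dist_lessD:
  assumes K: "K \<in> hyperspace m" and L: "L \<in> hyperspace m"
    and x: "x \<in> K" and e: "e > 0"
  shows "\<exists>y\<in>L. mdist m x y < hausdorff_dist m K L + e"
  using hausdorff_dist_le_iff[OF K L, of "hausdorff_dist m K L"] x e by blast

lemma hausdorff_dist_nonneg: "0 \<le> hausdorff_dist m K L"
proof (cases "K \<in> hyperspace m \<and> L \<in> hyperspace m")
  case True
  then obtain x where x: "x \<in> K" by (auto simp: hyperspace_def)
  have "0 \<le> hausdorff_dist m K L + e" if e: "e > 0" for e
  proof -
    obtain y where "mdist m x y < hausdorff_dist m K L + e"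
      using hausdorff_dist_lessD[OF _ _ x e] True by blast
    moreover have "0 \<le> mdist m x y" by simp
    ultimately show ?thesis by linarith
  qed
  then show ?thesis by (rule field_le_epsilon)
qed (auto simp: hausdorff_dist_def)

lemma hausdorff_dist_zeroD:
  assumes K: "K \<in> hyperspace m" and L: "L \<in> hyperspace m" and 0: "hausdorff_dist m K L = 0"
  shows "K \<subseteq> L"
proof
  interpret M: Metric_space "mspace m" "mdist m" by simp
  fix x assume x: "x \<in> K"
  have "closedin M.mtopology L"
    using L by (auto simp: hyperspace_def mtopology_of_def
        intro: compactin_imp_closedin M.Hausdorff_space_mtopology)
  moreover have "\<forall>r>0. \<exists>y\<in>L. y \<in> M.mball x r"
  proof (intro allI impI)
    fix r :: real assume "r > 0"
    then obtain y where "y \<in> L" "mdist m x y < r"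
      using hausdorff_dist_lessD[OF K L x, of r] 0 by auto
    then show "\<exists>y\<in>L. y \<in> M.mball x r"
      using hyperspace_subset[OF K] hyperspace_subset[OF L] x by auto
  qed
  then have "x \<in> M.mtopology closure_of L"
    using hyperspace_subset[OF K] x by (auto simp: M.metric_closure_of)
  ultimately show "x \<in> L" by (simp add: closure_of_closedin)
qed

lemma Metric_space_hausdorff_dist: "Metric_space (hyperspace m) (hausdorff_dist m)"
proof
  fix K L N :: "'a set"
  show "0 \<le> hausdorff_dist m K L" by (rule hausdorff_dist_nonneg)
  show "hausdorff_dist m K L = hausdorff_dist m L K" by (rule hausdorff_dist_commute)
  assume K: "K \<in> hyperspace m" and L: "L \<in> hyperspace m"
  show "hausdorff_dist m K L = 0 \<longleftrightarrow> K = L"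
  proof
    assume "hausdorff_dist m K L = 0"
    then show "K = L"
      using hausdorff_dist_zeroD[OF K L] hausdorff_dist_zeroD[OF L K]
      by (simp add: hausdorff_dist_commute[of m L K])
  next
    assume "K = L"
    have "\<exists>y\<in>K. mdist m x y < 0 + e" if "x \<in> K" "e > 0" for x e
    proof
      have "x \<in> mspace m" using that hyperspace_subset[OF K] by blast
      then show "mdist m x x < 0 + e" using that by (simp del: mdist_zero add: mdist_zero[THEN iffD2])
    qed (use that in blast)
    then have "hausdorff_dist m K L \<le> 0"
      unfolding \<open>K = L\<close>[symmetric] hausdorff_dist_le_iff[OF K K] by blast
    then show "hausdorff_dist m K L = 0"
      using hausdorff_dist_nonneg[of m K L] by linarith
  qed
  assume N: "N \<in> hyperspace m"
  have *: "\<exists>z\<in>C. mdist m x z < hausdorff_dist m A B + hausdorff_dist m B C + e"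
    if A: "A \<in> hyperspace m" and B: "B \<in> hyperspace m" and C: "C \<in> hyperspace m"
      and x: "x \<in> A" and e: "e > 0" for A B C x e
  proof -
    have e2: "e / 2 > 0" using e by simp
    obtain y where y: "y \<in> B" "mdist m x y < hausdorff_dist m A B + e / 2"
      using hausdorff_dist_lessD[OF A B x e2] by blast
    obtain z where z: "z \<in> C" "mdist m y z < hausdorff_dist m B C + e / 2"
      using hausdorff_dist_lessD[OF B C y(1) e2] by blast
    have "mdist m x z \<le> mdist m x y + mdist m y z"
      using x y(1) z(1) hyperspace_subset[OF A] hyperspace_subset[OF B] hyperspace_subset[OF C]
      by (intro mdist_triangle) auto
    then show ?thesis using y z by (intro bexI[of _ z]) auto
  qed
  have "hausdorff_dist m N L + hausdorff_dist m L K = hausdorff_dist m K L + hausdorff_dist m L N"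
    by (simp add: hausdorff_dist_commute[of m N L] hausdorff_dist_commute[of m L K])
  then show "hausdorff_dist m K N \<le> hausdorff_dist m K L + hausdorff_dist m L N"
    unfolding hausdorff_dist_le_iff[OF K N]
    using *[OF K L N] *[OF N L K] by auto
qed

lemma mspace_hyperspace_metric [simp]: "mspace (hyperspace_metric m) = hyperspace m"
  and mdist_hyperspace_metric [simp]: "mdist (hyperspace_metric m) = hausdorff_dist m"
  unfolding hyperspace_metric_def
  by (simp_all add: Metric_space.mspace_metric Metric_space.mdist_metric
      Metric_space_hausdorff_dist)

lemma Lipschitz_induced_map:
  assumes f: "Lipschitz_continuous_map m m f"
  shows "Lipschitz_continuous_map (hyperspace_metric m) (hyperspace_metric m) (induced_map f)"
proof -
  obtain B where "B > 0" and B: "\<And>x y. x \<in> mspace m \<Longrightarrow> y \<in> mspace m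
      \<Longrightarrow> mdist m (f x) (f y) \<le> B * mdist m x y"
    using f unfolding Lipschitz_continuous_map_pos by blast
  have cont: "continuous_map (mtopology_of m) (mtopology_of m) f"
    using f by (rule Lipschitz_continuous_imp_continuous_map)
  have im: "induced_map f K \<in> hyperspace m" if "K \<in> hyperspace m" for K
    using that image_compactin[OF _ cont] by (auto simp: hyperspace_def induced_map_def)
  have *: "\<exists>y\<in>induced_map f L. mdist m x y < B * hausdorff_dist m K L + e"
    if K: "K \<in> hyperspace m" and L: "L \<in> hyperspace m"
      and x: "x \<in> induced_map f K" and e: "e > 0" for K L x e
  proof -
    obtain u where u: "u \<in> K" "x = f u" using x by (auto simp: induced_map_def)
    have "e / B > 0" using e \<open>B > 0\<close> by simp
    then obtain v where v: "v \<in> L" "mdist m u v < hausdorff_dist m K L + e / B"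
      using hausdorff_dist_lessD[OF K L u(1)] by blast
    have "mdist m (f u) (f v) \<le> B * mdist m u v"
      using u v hyperspace_subset[OF K] hyperspace_subset[OF L] by (intro B) auto
    also have "\<dots> < B * (hausdorff_dist m K L + e / B)"
      using v(2) \<open>B > 0\<close> by (rule mult_strict_left_mono)
    also have "\<dots> = B * hausdorff_dist m K L + e"
      using \<open>B > 0\<close> by (simp add: field_simps)
    finally show ?thesis using u v by (auto simp: induced_map_def)
  qed
  have "hausdorff_dist m (induced_map f K) (induced_map f L) \<le> B * hausdorff_dist m K L"
    if K: "K \<in> hyperspace m" and L: "L \<in> hyperspace m" for K L
    unfolding hausdorff_dist_le_iff[OF im[OF K] im[OF L]]
    using *[OF K L] *[OF L K] by (simp add: hausdorff_dist_commute[of m L K])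
  then show ?thesis
    unfolding Lipschitz_continuous_map_def using im by auto
qed


section \<open>Expansiveness\<close>

text \<open>
  This is meant for continuous self-maps of the metric space. The shift and the map it induces
  on the hyperspace are such maps, by \<open>Lipschitz_shift\<close> and \<open>Lipschitz_induced_map\<close>.
\<close>

definition expansive :: "'a metric \<Rightarrow> ('a \<Rightarrow> 'a) \<Rightarrow> bool" where
  "expansive m f \<longleftrightarrow>
     (\<exists>\<delta>>0. \<forall>x\<in>mspace m. \<forall>y\<in>mspace m. x \<noteq> y \<longrightarrow>
        (\<exists>k. mdist m ((f ^^ k) x) ((f ^^ k) y) > \<delta>))"

end

(*
  Points embed isometrically into the hyperspace as singletons, so an expansivity constant of the
  induced map is one of the map itself. For the failure of the converse take the full shift over a
  discrete alphabet and x = 1 0 0 0 ..., y = 0^n 1 0 0 ..., z = 1 0^(n-1) 1 0 0 .... The sets {x, y}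
  and {x, y, z} are different, but at time 0 the point z is within 2^(-n) of x, and from time 1 on
  the orbits of z and y coincide.
*)
theory Submission
  imports Defs
begin

lemma finite_in_hyperspace:
  assumes "finite K" "K \<noteq> {}" "K \<subseteq> mspace m"
  shows "K \<in> hyperspace m"
  using assms by (simp add: hyperspace_def finite_imp_compactin)

text \<open>A point at distance at most \<open>r\<close> is at distance less than
  \<open>r + e\<close> for every \<open>e > 0\<close>, which removes the slack from
  \<open>hausdorff_dist_le_iff\<close>. This suits finite sets, where nearest points are
  attained.\<close>

lemma hausdorff_dist_leI:
  assumes "K \<in> hyperspace m" "L \<in> hyperspace m"
    and "\<And>x. x \<in> K \<Longrightarrow> \<exists>y\<in>L. mdist m x y \<le> r"
    and "\<And>y. y \<in> L \<Longrightarrow> \<exists>x\<in>K. mdist m y x \<le> r"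
  shows "hausdorff_dist m K L \<le> r"
  unfolding hausdorff_dist_le_iff[OF assms(1,2)]
proof (intro conjI ballI allI impI)
  show "\<exists>y\<in>L. mdist m x y < r + e" if "x \<in> K" "e > 0" for x e
    using assms(3)[OF that(1)] that(2) by force
  show "\<exists>x\<in>K. mdist m y x < r + e" if "y \<in> L" "e > 0" for y e
    using assms(4)[OF that(1)] that(2) by force
qed

text \<open>This direction carries expansivity from sets to points: if the singletons are more than
  \<delta> apart, so are the points.\<close>

lemma hausdorff_dist_singletons_le:
  assumes "x \<in> mspace m" "y \<in> mspace m"
  shows "hausdorff_dist m {x} {y} \<le> mdist m x y"
  using assms by (intro hausdorff_dist_leI finite_in_hyperspace) (auto simp: mdist_commute)

lemma funpow_induced_map: "(induced_map f ^^ k) K = (f ^^ k) ` K"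
  by (induction k) (simp_all add: induced_map_def image_comp)

lemma expansive_if_expansive_hyperspace:
  assumes f: "f ` mspace m \<subseteq> mspace m"
    and exp: "expansive (hyperspace_metric m) (induced_map f)"
  shows "expansive m f"
proof -
  obtain \<delta> where "\<delta> > 0" and \<delta>: "\<And>K L. K \<in> hyperspace m \<Longrightarrow> L \<in> hyperspace m \<Longrightarrow> K \<noteq> L \<Longrightarrow>
      \<exists>k. hausdorff_dist m ((f ^^ k) ` K) ((f ^^ k) ` L) > \<delta>"
    using exp by (auto simp: expansive_def funpow_induced_map)
  \<comment> \<open>Orbits stay in the space, so the bound for singletons applies at every
    time.\<close>
  have iter: "(f ^^ k) x \<in> mspace m" if "x \<in> mspace m" for k x
    using that f by (induction k) auto
  have "\<exists>k. mdist m ((f ^^ k) x) ((f ^^ k) y) > \<delta>"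
    if xy: "x \<in> mspace m" "y \<in> mspace m" "x \<noteq> y" for x y
  proof -
    obtain k where "hausdorff_dist m {(f ^^ k) x} {(f ^^ k) y} > \<delta>"
      using \<delta>[of "{x}" "{y}"] xy by (auto simp: finite_in_hyperspace)
    then show ?thesis
      using hausdorff_dist_singletons_le[OF iter iter, OF xy(1,2)] order_less_le_trans by blast
  qed
  with \<open>\<delta> > 0\<close> show ?thesis by (auto simp: expansive_def)
qed

lemma funpow_shift: "(shift ^^ k) x = (\<lambda>i. x (i + k))"
  by (induction k) (simp_all add: shift_def)

text \<open>The terms of the series are nonnegative, and the one at index 0 has weight 1.\<close>

lemma letter_dist_0_le_seq_dist: "letter_dist \<A> (x 0) (y 0) \<le> seq_dist \<A> x y"
  using sum_le_suminf[OF summable_seq_dist, of "{0}" \<A> x y]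
  by (simp add: seq_dist_def letter_dist_bounds(1))

text \<open>Away from \<open>i\<close> the letters agree and lie in the alphabet, so their distance
  is 0 and a single term of the series survives.\<close>

lemma seq_dist_single_difference:
  assumes "x i \<in> letters \<A>" "\<And>j. y j \<in> letters \<A>" "\<And>j. j \<noteq> i \<Longrightarrow> x j = y j"
  shows "seq_dist \<A> x y = letter_dist \<A> (x i) (y i) / 2 ^ i"
proof -
  interpret Metric_space "letters \<A>" "letter_dist \<A>" by (rule Metric_space_letter_dist)
  show ?thesis
    unfolding seq_dist_def using assms by (subst suminf_finite[of "{i}"]) auto
qed

lemma subshift_full: "letters \<A> \<noteq> {} \<Longrightarrow> subshift \<A> (sequences \<A>)"
  using closedin_topspace[of "mtopology_of (seq_metric \<A>)"]
  by (auto simp: subshift_def sequences_def shift_def)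

text \<open>Distinct sequences differ at some index \<open>k\<close>, and \<open>k\<close> shifts
  bring this difference to index 0, where it contributes 1. Thus 1/2, being less than 1, is an
  expansivity constant.\<close>

lemma expansive_discrete_subshift:
  assumes "subshift (Discrete_Alphabet A) \<Omega>"
  shows "expansive (subshift_metric (Discrete_Alphabet A) \<Omega>) shift"
  unfolding expansive_def mdist_subshift_metric
proof (intro exI[of _ "1/2 :: real"] conjI ballI impI)
  fix x y :: "nat \<Rightarrow> 'a" assume "x \<noteq> y"
  then obtain k where "x k \<noteq> y k" by auto
  then have "seq_dist (Discrete_Alphabet A) ((shift ^^ k) x) ((shift ^^ k) y) \<ge> 1"
    using letter_dist_0_le_seq_dist[of "Discrete_Alphabet A" "(shift ^^ k) x" "(shift ^^ k) y"]
    by (simp add: funpow_shift discrete_metric.dd_def)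
  then show "\<exists>k. 1/2 < seq_dist (Discrete_Alphabet A) ((shift ^^ k) x) ((shift ^^ k) y)"
    by (intro exI[of _ k]) simp
qed simp

lemma not_expansive_hyperspace_full_shift:
  assumes ab: "a \<in> A" "b \<in> A" "a \<noteq> b"
  defines "\<A> \<equiv> Discrete_Alphabet A"
  shows "\<not> expansive (hyperspace_metric (subshift_metric \<A> (sequences \<A>))) (induced_map shift)"
proof -
  let ?m = "subshift_metric \<A> (sequences \<A>)"
  have sub: "subshift \<A> (sequences \<A>)"
    by (rule subshift_full) (use ab in \<open>auto simp: \<A>_def\<close>)
  interpret Metric_space "sequences \<A>" "seq_dist \<A>" by (rule Metric_space_seq_dist)
  \<comment> \<open>Every candidate constant \<delta> is refuted by its own pair of sets, whose
    orbits never separate by more than \<delta>.\<close>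
  have "\<exists>K\<in>hyperspace ?m. \<exists>L\<in>hyperspace ?m. K \<noteq> L \<and>
      (\<forall>k. hausdorff_dist ?m ((shift ^^ k) ` K) ((shift ^^ k) ` L) \<le> \<delta>)"
    if "\<delta> > 0" for \<delta> :: real
  proof -
    obtain n0 where "(1/2) ^ n0 < \<delta>" using real_arch_pow_inv[OF \<open>\<delta> > 0\<close>, of "1/2"] by auto
    \<comment> \<open>The successor ensures \<open>n > 0\<close>; for \<open>n = 0\<close> the three
      sequences below would coincide.\<close>
    moreover define n where "n = Suc n0"
    ultimately have n: "n > 0" "1 / 2 ^ n \<le> \<delta>"
      by (auto simp: field_simps intro: order_trans[rotated])
    define x where "x = (\<lambda>i::nat. if i = 0 then b else a)"
    define y where "y = (\<lambda>i. if i = n then b else a)"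
    define z where "z = (\<lambda>i::nat. if i = 0 \<or> i = n then b else a)"
    let ?K = "{x, y}" and ?L = "{x, y, z}"
    have seqs: "x \<in> sequences \<A>" "y \<in> sequences \<A>" "z \<in> sequences \<A>"
      using ab by (auto simp: sequences_def \<A>_def x_def y_def z_def)
    have "z 0 \<noteq> y 0" "z n \<noteq> x n" using ab n by (auto simp: x_def y_def z_def)
    then have "?K \<noteq> ?L" by auto
    have closed: "(shift ^^ k) u \<in> sequences \<A>" if "u \<in> sequences \<A>" for k u
      using that by (auto simp: sequences_def funpow_shift)
    have hyp: "(shift ^^ k) ` M \<in> hyperspace ?m" if "M \<in> {?K, ?L}" for k M
      using that seqs closed
      by (intro finite_in_hyperspace) (auto simp: mspace_subshift_metric[OF sub])
    \<comment> \<open>Since \<open>x\<close> and \<open>y\<close> belong to both sets, only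
      \<open>z\<close> needs a partner: \<open>x\<close> at time 0 and \<open>y\<close> from time 1
      on.\<close>
    have near: "\<exists>v\<in>?K. seq_dist \<A> ((shift ^^ k) z) ((shift ^^ k) v) \<le> \<delta>" for k
    proof (cases k)
      case 0
      have "seq_dist \<A> z x = letter_dist \<A> (z n) (x n) / 2 ^ n"
        by (rule seq_dist_single_difference) (use ab in \<open>auto simp: \<A>_def x_def z_def\<close>)
      also have "\<dots> \<le> 1 / 2 ^ n"
        using letter_dist_bounds(2) by (intro divide_right_mono) auto
      finally show ?thesis using 0 n by auto
    next
      case (Suc j)
      \<comment> \<open>As \<open>n > 0\<close>, the sequences \<open>y\<close> and \<open>z\<close>
        differ only at index 0, which the first shift deletes.\<close>
      then have "(shift ^^ k) z = (shift ^^ k) y"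
        unfolding funpow_shift y_def z_def by auto
      then show ?thesis using closed seqs \<open>\<delta> > 0\<close> by auto
    qed
    have "hausdorff_dist ?m ((shift ^^ k) ` ?K) ((shift ^^ k) ` ?L) \<le> \<delta>" for k
    proof (rule hausdorff_dist_leI)
      \<comment> \<open>Points of the smaller image lie in the larger one too and are matched with
        themselves.\<close>
      have self: "seq_dist \<A> u u \<le> \<delta>" if "u \<in> (shift ^^ k) ` ?K" for u
        using that closed seqs \<open>\<delta> > 0\<close> by auto
      show "\<exists>v\<in>(shift ^^ k) ` ?L. mdist ?m u v \<le> \<delta>" if "u \<in> (shift ^^ k) ` ?K" for u
        using self[OF that] that by auto
      show "\<exists>u\<in>(shift ^^ k) ` ?K. mdist ?m v u \<le> \<delta>" if "v \<in> (shift ^^ k) ` ?L" for v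
        using self[of v] near[of k] that by auto
    qed (use hyp in blast)+
    moreover have "?K \<in> hyperspace ?m" "?L \<in> hyperspace ?m"
      using hyp[of ?K 0] hyp[of ?L 0] by simp_all
    ultimately show ?thesis
      using \<open>?K \<noteq> ?L\<close> by (intro bexI[of _ ?K] bexI[of _ ?L] conjI allI)
  qed
  then show ?thesis
    unfolding expansive_def funpow_induced_map mspace_hyperspace_metric mdist_hyperspace_metric
    by (meson not_less)
qed

theorem proposition3p16:
  shows "(\<forall>(\<A> :: 'a alphabet) \<Omega>. subshift \<A> \<Omega> \<longrightarrow>
            expansive (hyperspace_metric (subshift_metric \<A> \<Omega>)) (induced_map shift) \<longrightarrow>
            expansive (subshift_metric \<A> \<Omega>) shift)
       \<and> (\<exists>(\<B> :: nat alphabet) \<Omega>. subshift \<B> \<Omega> \<and>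
            expansive (subshift_metric \<B> \<Omega>) shift \<and>
            \<not> expansive (hyperspace_metric (subshift_metric \<B> \<Omega>)) (induced_map shift))"
proof (intro conjI allI impI)
  fix \<A> :: "'a alphabet" and \<Omega>
  assume sub: "subshift \<A> \<Omega>"
    and exp: "expansive (hyperspace_metric (subshift_metric \<A> \<Omega>)) (induced_map shift)"
  have "shift ` mspace (subshift_metric \<A> \<Omega>) \<subseteq> mspace (subshift_metric \<A> \<Omega>)"
    unfolding mspace_subshift_metric[OF sub] using sub by (simp add: subshift_def)
  then show "expansive (subshift_metric \<A> \<Omega>) shift"
    using exp by (rule expansive_if_expansive_hyperspace)
next
  \<comment> \<open>Two letters suffice: 0 is the background and 1 marks the special
    positions.\<close>
  let ?B = "Discrete_Alphabet {0, 1 :: nat}"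
  have sub: "subshift ?B (sequences ?B)" by (rule subshift_full) simp
  have "\<not> expansive (hyperspace_metric (subshift_metric ?B (sequences ?B))) (induced_map shift)"
    by (rule not_expansive_hyperspace_full_shift[of 0 _ 1]) simp_all
  with sub expansive_discrete_subshift[OF sub]
  show "\<exists>(\<B> :: nat alphabet) \<Omega>. subshift \<B> \<Omega> \<and>
      expansive (subshift_metric \<B> \<Omega>) shift \<and>
      \<not> expansive (hyperspace_metric (subshift_metric \<B> \<Omega>)) (induced_map shift)"
    by (intro exI conjI)
qed

end
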